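(* For every policy $\pi_e\in\Pi'_\Delta$, $$T\times\big|\nu(\pi_e;\mathcal D_0)-\nu^*(\pi_e;\mathcal D_0)\big|\longrightarrow 0\qquad\text{as } T\to\infty,$$ where $$\nu(\pi_e;\mathcal D_0)=\sigma^2\,\bar{\boldsymbol\phi}_{\Delta\pi}^T\Big(T\sum_{\mathbf x\in\mathcal A}\pi_e(\mathbf x)\mathbf x\mathbf x^T+\boldsymbol\Phi_0^T\boldsymbol\Phi_0\Big)^{-1}\bar{\boldsymbol\phi}_{\Delta\pi}$$ and $\nu^*(\pi_e;\mathcal D_0)$ is the variance of $\widehat V_{DM}(\pi_1;\mathcal D_0\cup\mathcal D_e)-\widehat V_{DM}(\pi_0;\mathcal D_0\cup\mathcal D_e)$, which equals $$\nu^*(\pi_e;\mathcal D_0)=\sigma^2\,\mathbb E_{\boldsymbol\Phi\sim\pi_e}\Big[\bar{\boldsymbol\phi}_{\Delta\pi}^T\big(\boldsymbol\Phi^T\boldsymbol\Phi+\boldsymbol\Phi_0^T\boldsymbol\Phi_0\big)^{-1}\bar{\boldsymbol\phi}_{\Delta\pi}\Big].$$ In other words, $\nu(\pi_e;\mathcal D_0)$ is the asymptotic variance of $\widehat V_{DM}(\pi_1;\mathcal D_0\cup\mathcal D_e)-\widehat V_{DM}(\pi_0;\mathcal D_0\cup\mathcal D_e)$.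
   Context: Linear bandit. $\mathcal A\subset\mathbb R^d$ is a finite set of $K$ arms. Pulling arm $\mathbf x\in\mathcal A$ yields a random reward with mean $\mathbf x^T\boldsymbol\theta^*$, for an unknown fixed $\boldsymbol\theta^*\in\mathbb R^d$, and variance $\sigma^2$ (the same for all arms); rewards are independent given the arms pulled. A policy is a probability distribution $\pi$ on $\mathcal A$; its mean feature is $\bar{\boldsymbol\phi}_\pi=\sum_{\mathbf x\in\mathcal A}\pi(\mathbf x)\mathbf x$, and its value is $V(\pi)=\bar{\boldsymbol\phi}_\pi^T\boldsymbol\theta^*$. Fix a target policy $\pi_1$ and a baseline policy $\pi_0$ and put $\bar{\boldsymbol\phi}_{\Delta\pi}=\bar{\boldsymbol\phi}_{\pi_1}-\bar{\boldsymbol\phi}_{\pi_0}$. $\mathcal D_0$ is an existing dataset of arm–reward pairs, with arms regarded as fixed (not depending on $T$) and stacked as rows of the matrix $\boldsymbol\Phi_0$, which is assumed to be of full column rank $d$. Under an exploration policy $\pi_e$, arms $\mathbf x_1,\dots,\mathbf x_T$ are drawn i.i.d. from $\pi_e$, $\boldsymbol\Phi=(\mathbf x_1,\dots,\mathbf x_T)^T$ (written $\boldsymbol\Phi\sim\pi_e$), and the corresponding rewards $R_1,\dots,R_T$ are observed, giving the dataset $\mathcal D_e=\{(\mathbf x_t,R_t)\}_{t=1}^T$, independent of $\mathcal D_0$. Direct method (DM) estimator: for a dataset $\mathcal D=\{(\mathbf x_i,R_i)\}$, let $\hat{\boldsymbol\theta}=(\sum_i\mathbf x_i\mathbf x_i^T)^{+}\sum_i\mathbf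 x_iR_i$ (least squares) and $\widehat V_{DM}(\pi;\mathcal D)=\bar{\boldsymbol\phi}_\pi^T\hat{\boldsymbol\theta}$. $\Pi'_\Delta$ is the set of policies $\pi$ such that $\sum_{\mathbf x\in\mathcal A}\pi(\mathbf x)\mathbf x\mathbf x^T$ is invertible. The policy $\pi_e$, the arms, $\mathcal D_0$, $\pi_0,\pi_1$ are fixed as $T\to\infty$. *)

theory Defs
  imports "HOL-Probability.Probability" "HOL-Library.Multiset"
begin

definition outer :: "real^'d \<Rightarrow> real^'d^'d" where
  "outer x = (\<chi> i j. x $ i * x $ j)"

text \<open>Moore--Penrose pseudoinverse, characterized by the four Penrose conditions.\<close>

definition is_pinv :: "real^'n^'m \<Rightarrow> real^'m^'n \<Rightarrow> bool" where
  "is_pinv A B \<longleftrightarrow>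
     A ** B ** A = A \<and> B ** A ** B = B \<and>
     transpose (A ** B) = A ** B \<and> transpose (B ** A) = B ** A"

definition pinv :: "real^'n^'m \<Rightarrow> real^'m^'n" where
  "pinv A = (THE B. is_pinv A B)"

lemma is_pinv_unique:
  assumes B: "is_pinv A B" and C: "is_pinv A C"
  shows "B = C"
proof -
  have AB: "A ** B = A ** C"
  proof -
    have "A ** B = transpose (A ** B)" using B by (simp add: is_pinv_def)
    also have "\<dots> = transpose ((A ** C) ** (A ** B))"
      using C by (simp add: is_pinv_def matrix_mul_assoc)
    also have "\<dots> = (A ** B) ** (A ** C)"
      using B C by (simp add: is_pinv_def matrix_transpose_mul)
    also have "\<dots> = A ** C" using B by (simp add: is_pinv_def matrix_mul_assoc)
    finally show ?thesis .
  qed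
  have BA: "B ** A = C ** A"
  proof -
    have "B ** A = transpose (B ** A)" using B by (simp add: is_pinv_def)
    also have "\<dots> = transpose ((B ** A) ** (C ** A))"
      using C by (simp add: is_pinv_def flip: matrix_mul_assoc)
    also have "\<dots> = (C ** A) ** (B ** A)"
      using B C by (simp add: is_pinv_def matrix_transpose_mul)
    also have "\<dots> = C ** A" using B by (simp add: is_pinv_def flip: matrix_mul_assoc)
    finally show ?thesis .
  qed
  have "B = B ** (A ** B)" using B by (simp add: is_pinv_def matrix_mul_assoc)
  also have "\<dots> = C ** A ** C" by (simp add: AB matrix_mul_assoc BA)
  also have "\<dots> = C" using C by (simp add: is_pinv_def)
  finally show ?thesis .
qed

lemma pinv_eqI: "is_pinv A B \<Longrightarrow> pinv A = B"
  unfolding pinv_def by (rule the_equality) (auto intro: is_pinv_unique)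

lemma pinv_invertible:
  fixes A :: "real^'n^'n"
  assumes "invertible A"
  shows "pinv A = matrix_inv A"
proof (rule pinv_eqI)
  have "A ** matrix_inv A = mat 1" "matrix_inv A ** A = mat 1"
    using someI_ex[OF assms[unfolded invertible_def]] by (simp_all add: matrix_inv_def)
  then show "is_pinv A (matrix_inv A)"
    by (simp add: is_pinv_def transpose_mat)
qed

definition policies :: "(real^'d) set \<Rightarrow> (real^'d) pmf set" where
  "policies A = {\<pi>. set_pmf \<pi> \<subseteq> A}"

definition mean_feature :: "(real^'d) set \<Rightarrow> (real^'d) pmf \<Rightarrow> real^'d" where
  "mean_feature A \<pi> = (\<Sum>x\<in>A. pmf \<pi> x *\<^sub>R x)"

definition policy_gram :: "(real^'d) set \<Rightarrow> (real^'d) pmf \<Rightarrow> real^'d^'d" where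
  "policy_gram A \<pi> = (\<Sum>x\<in>A. pmf \<pi> x *\<^sub>R outer x)"

definition invertible_policies :: "(real^'d) set \<Rightarrow> (real^'d) pmf set" where
  "invertible_policies A = {\<pi> \<in> policies A. invertible (policy_gram A \<pi>)}"

text \<open>A dataset is a multiset of arm--reward pairs, so the union of two datasets is the
  multiset sum \<open>+\<close>.\<close>

type_synonym 'd dataset = "((real^'d) \<times> real) multiset"

definition least_squares :: "'d::finite dataset \<Rightarrow> real^'d" where
  "least_squares D = pinv (\<Sum>(x, r)\<in>#D. outer x) *v (\<Sum>(x, r)\<in>#D. r *\<^sub>R x)"

definition V_DM :: "(real^'d) set \<Rightarrow> (real^'d) pmf \<Rightarrow> 'd::finite dataset \<Rightarrow> real" where
  "V_DM A \<pi> D = mean_feature A \<pi> \<bullet> least_squares D"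

text \<open>\<open>P x\<close> is the law of the reward obtained by pulling arm \<open>x\<close>.\<close>

locale linear_bandit =
  fixes A :: "(real^'d) set"
    and \<theta> :: "real^'d"
    and \<sigma> :: real
    and P :: "real^'d \<Rightarrow> real measure"
  assumes finite_arms: "finite A"
    and prob_space_reward: "x \<in> A \<Longrightarrow> prob_space (P x)"
    and sets_reward: "x \<in> A \<Longrightarrow> sets (P x) = sets borel"
    and square_integrable_reward: "x \<in> A \<Longrightarrow> integrable (P x) (\<lambda>r. r\<^sup>2)"
    and mean_reward: "x \<in> A \<Longrightarrow> prob_space.expectation (P x) (\<lambda>r. r) = x \<bullet> \<theta>"
    and variance_reward: "x \<in> A \<Longrightarrow> prob_space.variance (P x) (\<lambda>r. r) = \<sigma>\<^sup>2"

text \<open>The rows of \<open>\<Phi>\<^sub>0\<close> are the (deterministic) arms of the existing dataset, with random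
  rewards \<open>R\<^sub>0\<close>; \<open>X t\<close> and \<open>R t\<close> are the arm and the reward of exploration round \<open>t\<close>,
  with rounds counted from \<open>0\<close>. Given its arm, each reward follows the law \<open>P\<close> of that arm.
  Joint independence of all arm--reward pairs makes the exploration arms i.i.d., the rewards
  independent given the arms, and the two datasets independent.\<close>

locale bandit_exploration =
  linear_bandit A \<theta> \<sigma> P + prob_space M
  for A :: "(real^'d) set" and \<theta> \<sigma> P and M :: "'w measure" +
  fixes \<Phi>\<^sub>0 :: "real^'d^'n"
    and R\<^sub>0 :: "'n \<Rightarrow> 'w \<Rightarrow> real"
    and \<pi>\<^sub>e :: "(real^'d) pmf"
    and X :: "nat \<Rightarrow> 'w \<Rightarrow> real^'d"
    and R :: "nat \<Rightarrow> 'w \<Rightarrow> real"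
  assumes existing_arms: "\<Phi>\<^sub>0 $ i \<in> A"
    and full_column_rank: "rank \<Phi>\<^sub>0 = CARD('d)"
    and exploration_policy: "\<pi>\<^sub>e \<in> policies A"
    and indep_data: "indep_vars (\<lambda>_. borel)
          (case_sum (\<lambda>i \<omega>. (\<Phi>\<^sub>0 $ i, R\<^sub>0 i \<omega>)) (\<lambda>t \<omega>. (X t \<omega>, R t \<omega>))) UNIV"
    and existing_reward_law: "distr M borel (R\<^sub>0 i) = P (\<Phi>\<^sub>0 $ i)"
    and exploration_law: "x \<in> A \<Longrightarrow> B \<in> sets borel \<Longrightarrow>
          prob {\<omega> \<in> space M. X t \<omega> = x \<and> R t \<omega> \<in> B} = pmf \<pi>\<^sub>e x * measure (P x) B"

definition existing_data :: "real^'d^'n \<Rightarrow> ('n \<Rightarrow> 'w \<Rightarrow> real) \<Rightarrow> 'w \<Rightarrow> 'd::finite dataset" where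
  "existing_data \<Phi>\<^sub>0 R\<^sub>0 \<omega> = {# (\<Phi>\<^sub>0 $ i, R\<^sub>0 i \<omega>). i \<in># mset_set UNIV #}"

definition exploration_data ::
  "(nat \<Rightarrow> 'w \<Rightarrow> real^'d) \<Rightarrow> (nat \<Rightarrow> 'w \<Rightarrow> real) \<Rightarrow> nat \<Rightarrow> 'w \<Rightarrow> 'd::finite dataset" where
  "exploration_data X R T \<omega> = {# (X t \<omega>, R t \<omega>). t \<in># mset_set {..<T} #}"

definition nu ::
  "(real^'d) set \<Rightarrow> real \<Rightarrow> (real^'d) pmf \<Rightarrow> (real^'d) pmf \<Rightarrow> (real^'d) pmf \<Rightarrow> real^'d^'n
     \<Rightarrow> nat \<Rightarrow> real" where
  "nu A \<sigma> \<pi>\<^sub>1 \<pi>\<^sub>0 \<pi>\<^sub>e \<Phi>\<^sub>0 T =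
     (let \<phi> = mean_feature A \<pi>\<^sub>1 - mean_feature A \<pi>\<^sub>0
      in \<sigma>\<^sup>2 * (\<phi> \<bullet> (matrix_inv (real T *\<^sub>R policy_gram A \<pi>\<^sub>e + transpose \<Phi>\<^sub>0 ** \<Phi>\<^sub>0) *v \<phi>)))"

definition nu_star ::
  "'w measure \<Rightarrow> (real^'d) set \<Rightarrow> (real^'d) pmf \<Rightarrow> (real^'d) pmf \<Rightarrow> real^'d^'n
     \<Rightarrow> ('n \<Rightarrow> 'w \<Rightarrow> real) \<Rightarrow> (nat \<Rightarrow> 'w \<Rightarrow> real^'d) \<Rightarrow> (nat \<Rightarrow> 'w \<Rightarrow> real) \<Rightarrow> nat \<Rightarrow> real" where
  "nu_star M A \<pi>\<^sub>1 \<pi>\<^sub>0 \<Phi>\<^sub>0 R\<^sub>0 X R T =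
     prob_space.variance M (\<lambda>\<omega>.
       V_DM A \<pi>\<^sub>1 (existing_data \<Phi>\<^sub>0 R\<^sub>0 \<omega> + exploration_data X R T \<omega>) -
       V_DM A \<pi>\<^sub>0 (existing_data \<Phi>\<^sub>0 R\<^sub>0 \<omega> + exploration_data X R T \<omega>))"

text \<open>Here \<open>\<Sum>t<T. outer (X t \<omega>)\<close> is \<open>\<Phi>\<^sup>T \<Phi>\<close> for the matrix \<open>\<Phi>\<close> with rows \<open>X 0 \<omega>, \<dots>, X (T - 1) \<omega>\<close>.\<close>

definition expected_form ::
  "'w measure \<Rightarrow> (real^'d) set \<Rightarrow> (real^'d) pmf \<Rightarrow> (real^'d) pmf \<Rightarrow> real^'d^'n
     \<Rightarrow> (nat \<Rightarrow> 'w \<Rightarrow> real^'d) \<Rightarrow> nat \<Rightarrow> real" where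
  "expected_form M A \<pi>\<^sub>1 \<pi>\<^sub>0 \<Phi>\<^sub>0 X T =
     (let \<phi> = mean_feature A \<pi>\<^sub>1 - mean_feature A \<pi>\<^sub>0
      in prob_space.expectation M (\<lambda>\<omega>.
           \<phi> \<bullet> (matrix_inv ((\<Sum>t<T. outer (X t \<omega>)) + transpose \<Phi>\<^sub>0 ** \<Phi>\<^sub>0) *v \<phi>)))"

end

theory Submission imports Defs begin

text \<open>The error of the estimator is a linear combination of the reward residuals whose coefficients
  depend on the arms only. Given the arms the residuals are centred and uncorrelated with variance
  \<open>\<sigma>\<^sup>2\<close>, and the squared coefficients sum to the inverse Gram form; this is the formula for the variance.

  For the limit, Hoeffding's inequality puts the pull count of every arm within a factor
  \<open>1 \<plusminus> \<delta>\<close> of its mean, outside an event of probability exponentially small in \<open>T\<close>.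
  There the random and the mean design matrix are within the same factor in the Loewner order, so
  the two inverse forms differ by at most \<open>2\<delta>\<close> times the mean one, which is \<open>O(1/T)\<close>. On the
  exceptional event both forms are bounded by the inverse form of \<open>\<Phi>\<^sub>0\<^sup>T \<Phi>\<^sub>0\<close>. A plain variance bound
  on the counts would give only \<open>O(1/T)\<close> for its probability, which the factor \<open>T\<close> would cancel.\<close>

section \<open>Gram matrices\<close>

text \<open>Over the reals a nonnegative quadratic form does not force symmetry, so symmetry is part
  of the notion; it is phrased as self-adjointness, the shape in which later proofs use it.\<close>

definition psd :: "real^'d^'d \<Rightarrow> bool" where
  "psd G \<longleftrightarrow> (\<forall>u v. (G *v u) \<bullet> v = u \<bullet> (G *v v)) \<and> (\<forall>v. 0 \<le> v \<bullet> (G *v v))"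

text \<open>This is \<Phi>^T \<Phi> for the matrix with rows \<open>a j\<close>. An arbitrary index
  set lets one notion cover the rows of \<open>\<Phi>\<^sub>0\<close>, the observed arms and the
  deterministic arm configurations.\<close>

definition gram :: "('j \<Rightarrow> real^'d) \<Rightarrow> 'j set \<Rightarrow> real^'d^'d" where
  "gram a J = (\<Sum>j\<in>J. outer (a j))"

lemma sum_matrix_vector_mult:
  fixes B :: "'j \<Rightarrow> real^'n^'m"
  shows "(\<Sum>j\<in>J. B j) *v v = (\<Sum>j\<in>J. B j *v v)"
  by (induction J rule: infinite_finite_induct) (simp_all add: matrix_vector_mult_add_rdistrib)

lemma outer_mult_vector: "outer x *v v = (x \<bullet> v) *\<^sub>R x"
  by (simp add: vec_eq_iff outer_def matrix_vector_mult_def inner_vec_def sum_distrib_left ac_simps)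

lemma gram_mult_vector: "gram a J *v v = (\<Sum>j\<in>J. (a j \<bullet> v) *\<^sub>R a j)"
  by (simp add: gram_def sum_matrix_vector_mult outer_mult_vector)

lemma psd_outer: "psd (outer x)"
  by (simp add: psd_def outer_mult_vector inner_commute)

lemma psd_add: "psd F \<Longrightarrow> psd G \<Longrightarrow> psd (F + G)"
  by (simp add: psd_def matrix_vector_mult_add_rdistrib inner_add_left inner_add_right)

lemma psd_scaleR: "0 \<le> c \<Longrightarrow> psd G \<Longrightarrow> psd (c *\<^sub>R G)"
  by (simp add: psd_def flip: scaleR_matrix_vector_assoc)

lemma psd_sum: "(\<And>j. j \<in> J \<Longrightarrow> psd (B j)) \<Longrightarrow> psd (\<Sum>j\<in>J. B j)"
  by (induction J rule: infinite_finite_induct) (simp_all add: psd_add, simp_all add: psd_def)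

lemma psd_gram: "psd (gram a J)"
  by (simp add: gram_def psd_sum psd_outer)

lemma psd_policy_gram: "psd (policy_gram A \<pi>)"
  by (simp add: policy_gram_def psd_sum psd_scaleR psd_outer)

lemma transpose_mult_self: "transpose \<Phi> ** \<Phi> = gram (\<lambda>i. \<Phi> $ i) UNIV"
  by (simp add: vec_eq_iff gram_def outer_def matrix_matrix_mult_def transpose_def)

lemma matrix_inv_vector:
  fixes G :: "real^'d^'d"
  assumes "invertible G"
  shows "G *v (matrix_inv G *v v) = v" "matrix_inv G *v (G *v v) = v"
proof -
  have "G ** matrix_inv G = mat 1" "matrix_inv G ** G = mat 1"
    using someI_ex[OF assms[unfolded invertible_def]] by (simp_all add: matrix_inv_def)
  then show "G *v (matrix_inv G *v v) = v" "matrix_inv G *v (G *v v) = v"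
    by (simp_all add: matrix_vector_mul_assoc)
qed

lemma matrix_inv_symmetric:
  assumes "psd G" "invertible G"
  shows "u \<bullet> (matrix_inv G *v v) = (matrix_inv G *v u) \<bullet> v"
proof -
  have "u \<bullet> (matrix_inv G *v v) = (G *v (matrix_inv G *v u)) \<bullet> (matrix_inv G *v v)"
    using assms by (simp add: matrix_inv_vector)
  also have "\<dots> = (matrix_inv G *v u) \<bullet> (G *v (matrix_inv G *v v))"
    using assms by (simp add: psd_def)
  finally show ?thesis
    using assms by (simp add: matrix_inv_vector)
qed

lemma matrix_inv_form_nonneg:
  assumes "psd G" "invertible G"
  shows "0 \<le> v \<bullet> (matrix_inv G *v v)"
proof -
  have "0 \<le> (matrix_inv G *v v) \<bullet> (G *v (matrix_inv G *v v))"
    using assms by (simp add: psd_def)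
  then show ?thesis
    using assms by (simp add: matrix_inv_vector inner_commute)
qed

text \<open>Inversion reverses the Loewner order. The form of the inverse of \<open>F\<close> at
  \<phi> is the maximum over w of 2 (\<phi> \<bullet> w) - w \<bullet> F w, attained at
  \<open>u\<close>; nonnegativity of the square of \<open>u - w\<close> compares this maximum with
  its value at one trial vector.\<close>

lemma matrix_inv_form_antimono:
  assumes F: "psd F" "invertible F" and G: "invertible G" and c: "0 < c"
    and le: "\<And>v. c * (v \<bullet> (F *v v)) \<le> v \<bullet> (G *v v)"
  shows "c * (\<phi> \<bullet> (matrix_inv G *v \<phi>)) \<le> \<phi> \<bullet> (matrix_inv F *v \<phi>)"
proof -
  define u where "u = matrix_inv F *v \<phi>"
  \<comment> \<open>The scaling by \<open>c\<close> turns w \<bullet> G w into c (\<phi> \<bullet>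
    w), so \<open>c\<close> cancels against the hypothesis and leaves w \<bullet> F w \<le> \<phi>
    \<bullet> w.\<close>
  define w where "w = c *\<^sub>R (matrix_inv G *v \<phi>)"
  have Fu: "F *v u = \<phi>"
    using F by (simp add: u_def matrix_inv_vector)
  have "c * (w \<bullet> (F *v w)) \<le> w \<bullet> (G *v w)"
    by (rule le)
  also have "\<dots> = c * (\<phi> \<bullet> w)"
    using G by (simp add: w_def matrix_vector_mult_scaleR matrix_inv_vector inner_commute)
  finally have wFw: "w \<bullet> (F *v w) \<le> \<phi> \<bullet> w"
    using c by simp
  have "0 \<le> (u - w) \<bullet> (F *v (u - w))"
    using F by (simp add: psd_def)
  also have "\<dots> = u \<bullet> \<phi> - u \<bullet> (F *v w) - w \<bullet> \<phi> + w \<bullet> (F *v w)"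
    by (simp add: matrix_vector_mult_diff_distrib Fu inner_diff_left inner_diff_right)
  also have "u \<bullet> (F *v w) = \<phi> \<bullet> w"
    using F(1) by (simp add: psd_def flip: Fu)
  finally have "\<phi> \<bullet> w \<le> \<phi> \<bullet> u"
    using wFw by (simp add: inner_commute)
  then show ?thesis
    by (simp add: u_def w_def)
qed

text \<open>On a kernel vector both nonnegative terms of the quadratic form vanish, so \<Phi> maps
  it to zero and full column rank makes it zero. Hence the designs are invertible for every sample
  and every T, including T = 0.\<close>

lemma invertible_add_full_rank:
  fixes \<Phi> :: "real^'d^'n"
  assumes G: "psd G" and rank: "rank \<Phi> = CARD('d)"
  shows "invertible (G + transpose \<Phi> ** \<Phi>)"
proof -
  have "v = 0" if "(G + transpose \<Phi> ** \<Phi>) *v v = 0" for v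
  proof -
    have "0 = v \<bullet> ((G + transpose \<Phi> ** \<Phi>) *v v)"
      using that by simp
    also have "\<dots> = v \<bullet> (G *v v) + v \<bullet> ((transpose \<Phi> ** \<Phi>) *v v)"
      by (simp only: matrix_vector_mult_add_rdistrib inner_add_right)
    also have "v \<bullet> ((transpose \<Phi> ** \<Phi>) *v v) = (\<Sum>i\<in>UNIV. (\<Phi> $ i \<bullet> v)\<^sup>2)"
      by (simp add: transpose_mult_self gram_mult_vector inner_sum_right power2_eq_square inner_commute)
    finally have "(\<Sum>i\<in>UNIV. (\<Phi> $ i \<bullet> v)\<^sup>2) = 0"
      using G by (smt (verit) psd_def sum_nonneg zero_le_power2)
    then have "\<Phi> *v v = 0"
      by (simp add: vec_eq_iff matrix_vector_mul_component sum_nonneg_eq_0_iff)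
    then show "v = 0"
      using rank matrix_nonfull_linear_equations_eq[of \<Phi>] by auto
  qed
  then show ?thesis
    by (simp add: invertible_left_inverse matrix_left_invertible_ker)
qed

text \<open>Splitting each reward into a j \<bullet> \<theta> plus a residual, the first part
  reproduces \<theta> exactly. Symmetry of the inverse moves it onto \<phi>, so the coefficients of
  the residuals involve the arms only.\<close>

lemma least_squares_error:
  assumes inv: "invertible (gram a J)"
  shows "\<phi> \<bullet> (matrix_inv (gram a J) *v (\<Sum>j\<in>J. r j *\<^sub>R a j)) =
    \<phi> \<bullet> \<theta> + (\<Sum>j\<in>J. ((matrix_inv (gram a J) *v \<phi>) \<bullet> a j) * (r j - a j \<bullet> \<theta>))"
proof -
  have "(\<Sum>j\<in>J. r j *\<^sub>R a j) = gram a J *v \<theta> + (\<Sum>j\<in>J. (r j - a j \<bullet> \<theta>) *\<^sub>R a j)"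
    by (simp add: gram_mult_vector scaleR_diff_left flip: sum.distrib)
  then have "matrix_inv (gram a J) *v (\<Sum>j\<in>J. r j *\<^sub>R a j) =
      \<theta> + matrix_inv (gram a J) *v (\<Sum>j\<in>J. (r j - a j \<bullet> \<theta>) *\<^sub>R a j)"
    using inv by (simp add: matrix_vector_right_distrib matrix_inv_vector)
  then show ?thesis
    using inv by (simp add: inner_add_right matrix_inv_symmetric psd_gram inner_sum_right ac_simps)
qed

text \<open>With u the inverse applied to \<phi>, the sum of squares is u \<bullet> G u, and G u =
  \<phi>.\<close>

lemma sum_leverage_squares:
  assumes inv: "invertible (gram a J)"
  shows "(\<Sum>j\<in>J. ((matrix_inv (gram a J) *v \<phi>) \<bullet> a j)\<^sup>2) = \<phi> \<bullet> (matrix_inv (gram a J) *v \<phi>)"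
proof -
  let ?u = "matrix_inv (gram a J) *v \<phi>"
  have "\<phi> \<bullet> ?u = ?u \<bullet> (gram a J *v ?u)"
    using inv by (simp add: matrix_inv_vector inner_commute)
  then show ?thesis
    by (simp add: gram_mult_vector inner_sum_right power2_eq_square inner_commute)
qed

lemma measurable_vec_nth [measurable]: "(\<lambda>x::real^'d. x $ i) \<in> borel_measurable borel"
  by (intro borel_measurable_continuous_onI continuous_intros)

text \<open>By Cramer's rule the solution of a regular linear system is a rational function of the data.\<close>

lemma borel_measurable_matrix_inv_mult:
  fixes G :: "'w \<Rightarrow> real^'d^'d"
  assumes G: "\<And>i k. (\<lambda>\<omega>. G \<omega> $ i $ k) \<in> borel_measurable M"
    and b: "\<And>i. (\<lambda>\<omega>. b \<omega> $ i) \<in> borel_measurable M"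
    and inv: "\<And>\<omega>. invertible (G \<omega>)"
  shows "(\<lambda>\<omega>. \<phi> \<bullet> (matrix_inv (G \<omega>) *v b \<omega>)) \<in> borel_measurable M"
proof -
  have "matrix_inv (G \<omega>) *v b \<omega> =
      (\<chi> k. det (\<chi> i j. if j = k then b \<omega> $ i else G \<omega> $ i $ j) / det (G \<omega>))" for \<omega>
    using cramer[of "G \<omega>" "matrix_inv (G \<omega>) *v b \<omega>" "b \<omega>"] inv[of \<omega>]
    by (simp add: matrix_inv_vector invertible_det_nz)
  then have eq: "\<phi> \<bullet> (matrix_inv (G \<omega>) *v b \<omega>) =
      (\<Sum>k\<in>UNIV. \<phi> $ k * (det (\<chi> i j. if j = k then b \<omega> $ i else G \<omega> $ i $ j) / det (G \<omega>)))" for \<omega>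
    by (simp add: inner_vec_def)
  have det: "(\<lambda>\<omega>. det (H \<omega>)) \<in> borel_measurable M"
    if "\<And>i k. (\<lambda>\<omega>. H \<omega> $ i $ k) \<in> borel_measurable M" for H :: "'w \<Rightarrow> real^'d^'d"
    unfolding det_def using that by measurable
  show ?thesis
    unfolding eq
  proof (intro borel_measurable_sum borel_measurable_times borel_measurable_divide det G)
    fix i j k
    show "(\<lambda>\<omega>. (\<chi> i j. if j = k then b \<omega> $ i else G \<omega> $ i $ j) $ i $ j) \<in> borel_measurable M"
      using G b by (cases "j = k") simp_all
  qed simp
qed

section \<open>Moments of the least-squares error\<close>

text \<open>The product of indicators singles out the configurations that agree with
  \<open>a\<close> on \<open>J\<close>; extensionality of \<open>PiE\<close> leaves exactly one.
  This turns a function of random arms into a finite sum of indicators with deterministic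
  arms.\<close>

lemma sum_configurations:
  fixes H :: "('j \<Rightarrow> 'a) \<Rightarrow> real"
  assumes "finite J" "finite A" "\<And>j. j \<in> J \<Longrightarrow> a j \<in> A"
  shows "(\<Sum>\<alpha>\<in>PiE J (\<lambda>_. A). (\<Prod>j\<in>J. of_bool (a j = \<alpha> j)) * H \<alpha>) = H (restrict a J)"
proof -
  have "(\<Prod>j\<in>J. of_bool (a j = \<alpha> j)) = (of_bool (\<alpha> = restrict a J) :: real)"
    if "\<alpha> \<in> PiE J (\<lambda>_. A)" for \<alpha>
  proof -
    have "\<alpha> = restrict a J \<longleftrightarrow> (\<forall>j\<in>J. a j = \<alpha> j)"
      using that by (metis PiE_restrict restrict_apply' restrict_ext)
    then show ?thesis
      using assms(1) by (cases "\<forall>j\<in>J. a j = \<alpha> j") auto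
  qed
  then have "(\<Sum>\<alpha>\<in>PiE J (\<lambda>_. A). (\<Prod>j\<in>J. of_bool (a j = \<alpha> j)) * H \<alpha>) =
      (\<Sum>\<alpha>\<in>PiE J (\<lambda>_. A). if \<alpha> = restrict a J then H \<alpha> else 0)"
    by (intro sum.cong) auto
  also have "\<dots> = H (restrict a J)"
    using assms by (subst sum.delta) (auto intro: finite_PiE)
  finally show ?thesis .
qed

context linear_bandit
begin

text \<open>The second moment is written as a product to match the factors contributed by two
  residuals of the same round in \<open>residual_moments\<close>.\<close>

lemma reward_moments:
  assumes x: "x \<in> A"
  shows "has_bochner_integral (P x) (\<lambda>r. 1) (1::real)"
    and "has_bochner_integral (P x) (\<lambda>r. r - x \<bullet> \<theta>) 0"
    and "has_bochner_integral (P x) (\<lambda>r. (r - x \<bullet> \<theta>) * (r - x \<bullet> \<theta>)) (\<sigma>\<^sup>2)"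
proof -
  interpret Px: prob_space "P x"
    using x by (rule prob_space_reward)
  note sets_reward[OF x, measurable_cong]
  have sq: "integrable (P x) (\<lambda>r. r\<^sup>2)"
    using x by (rule square_integrable_reward)
  have int: "integrable (P x) (\<lambda>r. r)"
    by (rule Px.square_integrable_imp_integrable[OF _ sq]) simp
  show "has_bochner_integral (P x) (\<lambda>r. 1) (1::real)"
    by (simp add: has_bochner_integral_iff Px.prob_space)
  show "has_bochner_integral (P x) (\<lambda>r. r - x \<bullet> \<theta>) 0"
    using int mean_reward[OF x] by (simp add: has_bochner_integral_iff Px.prob_space)
  have "integrable (P x) (\<lambda>r. (r - x \<bullet> \<theta>)\<^sup>2)"
    using int sq by (simp add: power2_diff)
  then show "has_bochner_integral (P x) (\<lambda>r. (r - x \<bullet> \<theta>) * (r - x \<bullet> \<theta>)) (\<sigma>\<^sup>2)"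
    using variance_reward[OF x] mean_reward[OF x]
    by (simp add: has_bochner_integral_iff power2_eq_square)
qed

end

section \<open>Joint law of arms and rewards\<close>

context bandit_exploration
begin

text \<open>Existing and exploration rounds form one family indexed by a sum type. The existing arms
  become constant random variables, so both datasets are handled by the same argument.\<close>

definition arm :: "'n + nat \<Rightarrow> 'w \<Rightarrow> real^'d" where
  "arm = case_sum (\<lambda>i _. \<Phi>\<^sub>0 $ i) X"

definition reward :: "'n + nat \<Rightarrow> 'w \<Rightarrow> real" where
  "reward = case_sum R\<^sub>0 R"

text \<open>The law of a fixed existing arm is a point mass.\<close>

definition arm_prob :: "'n + nat \<Rightarrow> real^'d \<Rightarrow> real" where
  "arm_prob = case_sum (\<lambda>i x. of_bool (\<Phi>\<^sub>0 $ i = x)) (\<lambda>_. pmf \<pi>\<^sub>e)"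

lemma indep_pairs: "indep_vars (\<lambda>_. borel) (\<lambda>j \<omega>. (arm j \<omega>, reward j \<omega>)) UNIV"
proof -
  have "case_sum (\<lambda>i \<omega>. (\<Phi>\<^sub>0 $ i, R\<^sub>0 i \<omega>)) (\<lambda>t \<omega>. (X t \<omega>, R t \<omega>)) =
      (\<lambda>j \<omega>. (arm j \<omega>, reward j \<omega>))"
    by (auto simp: fun_eq_iff arm_def reward_def split: sum.splits)
  then show ?thesis
    using indep_data by simp
qed

lemma measurable_arm [measurable]: "arm j \<in> borel_measurable M"
  and measurable_reward [measurable]: "reward j \<in> borel_measurable M"
proof -
  have pair: "(\<lambda>\<omega>. (arm j \<omega>, reward j \<omega>)) \<in> M \<rightarrow>\<^sub>M borel \<Otimes>\<^sub>M borel"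
    using indep_pairs by (auto simp: indep_vars_def borel_prod)
  show "arm j \<in> borel_measurable M" "reward j \<in> borel_measurable M"
    using measurable_compose[OF pair measurable_fst] measurable_compose[OF pair measurable_snd] by simp_all
qed

lemma measurable_X [measurable]: "X t \<in> borel_measurable M"
  using measurable_arm[of "Inr t"] by (simp add: arm_def)

lemma arm_prob_nonneg: "0 \<le> arm_prob j x"
  by (simp add: arm_prob_def split: sum.splits)

lemma pair_law:
  assumes x: "x \<in> A" and B: "B \<in> sets borel"
  shows "prob {\<omega> \<in> space M. arm j \<omega> = x \<and> reward j \<omega> \<in> B} = arm_prob j x * measure (P x) B"
proof (cases j)
  case (Inl i)
  have "measure (distr M borel (R\<^sub>0 i)) B = prob {\<omega> \<in> space M. R\<^sub>0 i \<omega> \<in> B}"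
    using B measurable_reward[of "Inl i"]
    by (subst measure_distr) (auto simp: reward_def vimage_def Int_def conj_commute)
  then show ?thesis
    by (auto simp: Inl arm_def reward_def arm_prob_def existing_reward_law)
next
  case (Inr t)
  then show ?thesis
    using exploration_law[OF x B] by (simp add: arm_def reward_def arm_prob_def)
qed

text \<open>This is the conditional law of the reward given the arm in unnormalized form, which
  avoids dividing by a probability that may be zero.\<close>

lemma distr_reward_on_arm:
  assumes x: "x \<in> A"
  shows "distr (density M (indicator {\<omega> \<in> space M. arm j \<omega> = x})) borel (reward j) =
    density (P x) (\<lambda>_. ennreal (arm_prob j x))"
proof (rule measure_eqI)
  interpret Px: prob_space "P x"
    using x by (rule prob_space_reward)
  note sets_reward[OF x, measurable_cong]
  show "sets (distr (density M (indicator {\<omega> \<in> space M. arm j \<omega> = x})) borel (reward j)) =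
      sets (density (P x) (\<lambda>_. ennreal (arm_prob j x)))"
    using sets_reward[OF x] by simp
  fix B
  assume "B \<in> sets (distr (density M (indicator {\<omega> \<in> space M. arm j \<omega> = x})) borel (reward j))"
  then have B [measurable]: "B \<in> sets borel" by simp
  have "emeasure (distr (density M (indicator {\<omega> \<in> space M. arm j \<omega> = x})) borel (reward j)) B =
      (\<integral>\<^sup>+\<omega>. indicator {\<omega> \<in> space M. arm j \<omega> = x} \<omega> * indicator (reward j -` B \<inter> space M) \<omega> \<partial>M)"
    by (simp add: emeasure_distr emeasure_density)
  also have "\<dots> = (\<integral>\<^sup>+\<omega>. indicator {\<omega> \<in> space M. arm j \<omega> = x \<and> reward j \<omega> \<in> B} \<omega> \<partial>M)"
    by (intro nn_integral_cong) (auto simp: indicator_def)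
  also have "\<dots> = ennreal (arm_prob j x * measure (P x) B)"
    by (simp add: emeasure_eq_measure pair_law[OF x B])
  also have "\<dots> = emeasure (density (P x) (\<lambda>_. ennreal (arm_prob j x))) B"
    using B sets_reward[OF x]
    by (simp add: emeasure_density nn_integral_cmult_indicator ennreal_mult arm_prob_nonneg
        Px.emeasure_eq_measure)
  finally show "emeasure (distr (density M (indicator {\<omega> \<in> space M. arm j \<omega> = x})) borel (reward j)) B =
      emeasure (density (P x) (\<lambda>_. ennreal (arm_prob j x))) B" .
qed

lemma has_integral_on_arm:
  fixes g :: "real \<Rightarrow> real"
  assumes x: "x \<in> A" and g: "has_bochner_integral (P x) g m"
  shows "has_bochner_integral M (\<lambda>\<omega>. of_bool (arm j \<omega> = x) * g (reward j \<omega>)) (arm_prob j x * m)"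
proof -
  note sets_reward[OF x, measurable_cong]
  have [measurable]: "g \<in> borel_measurable borel"
    using g borel_measurable_has_bochner_integral measurable_cong_sets[OF sets_reward[OF x] refl] by blast
  let ?E = "{\<omega> \<in> space M. arm j \<omega> = x}"
  have "has_bochner_integral (density (P x) (\<lambda>_. ennreal (arm_prob j x))) g (arm_prob j x * m)"
    using g arm_prob_nonneg[of j x] by (auto simp: has_bochner_integral_iff integrable_density integral_density)
  then have "has_bochner_integral (distr (density M (\<lambda>\<omega>. ennreal (indicator ?E \<omega>))) borel (reward j)) g (arm_prob j x * m)"
    by (simp add: distr_reward_on_arm[OF x, symmetric] ennreal_indicator)
  then have "has_bochner_integral M (\<lambda>\<omega>. indicator ?E \<omega> *\<^sub>R g (reward j \<omega>)) (arm_prob j x * m)"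
    by (simp add: has_bochner_integral_iff integrable_distr_eq integral_distr integrable_density integral_density)
  then show ?thesis
    by (rule has_bochner_integral_cong[THEN iffD1, rotated -1]) (auto simp: indicator_def)
qed

text \<open>Each factor is a function of the arm-reward pair of its own round, so independence
  across rounds gives both integrability of the product and its factorization.\<close>

lemma has_integral_prod_on_arms:
  fixes g :: "'n + nat \<Rightarrow> real \<Rightarrow> real"
  assumes J: "finite J" and \<alpha>: "\<And>i. i \<in> J \<Longrightarrow> \<alpha> i \<in> A"
    and g: "\<And>i. i \<in> J \<Longrightarrow> has_bochner_integral (P (\<alpha> i)) (g i) (m i)"
  shows "has_bochner_integral M (\<lambda>\<omega>. \<Prod>i\<in>J. of_bool (arm i \<omega> = \<alpha> i) * g i (reward i \<omega>))
    (\<Prod>i\<in>J. arm_prob i (\<alpha> i) * m i)"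
proof -
  have g': "g i \<in> borel_measurable borel" if "i \<in> J" for i
    using borel_measurable_has_bochner_integral[OF g[OF that]]
      measurable_cong_sets[OF sets_reward[OF \<alpha>[OF that]] refl] by blast
  have "indep_vars (\<lambda>_. borel)
      (\<lambda>i \<omega>. (\<lambda>(x, r). of_bool (x = \<alpha> i) * g i r) (arm i \<omega>, reward i \<omega>)) J"
  proof (rule indep_vars_compose2[where M'="\<lambda>_. borel" and N="\<lambda>_. borel" and
        X="\<lambda>j \<omega>. (arm j \<omega>, reward j \<omega>)" and Y="\<lambda>i (x, r). of_bool (x = \<alpha> i) * g i r"])
    show "indep_vars (\<lambda>_. borel) (\<lambda>j \<omega>. (arm j \<omega>, reward j \<omega>)) J"
      using indep_pairs by (rule indep_vars_subset) simp
    show "(\<lambda>(x, r). of_bool (x = \<alpha> i) * g i r) \<in> borel_measurable borel" if "i \<in> J" for i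
      using g'[OF that] unfolding borel_prod[symmetric] by measurable
  qed
  then have ind: "indep_vars (\<lambda>_. borel) (\<lambda>i \<omega>. of_bool (arm i \<omega> = \<alpha> i) * g i (reward i \<omega>)) J"
    by simp
  have int: "has_bochner_integral M (\<lambda>\<omega>. of_bool (arm i \<omega> = \<alpha> i) * g i (reward i \<omega>)) (arm_prob i (\<alpha> i) * m i)"
    if "i \<in> J" for i
    using \<alpha>[OF that] g[OF that] by (rule has_integral_on_arm)
  show ?thesis
    using indep_vars_lebesgue_integral[OF J ind] indep_vars_integrable[OF J ind] int
    by (simp add: has_bochner_integral_iff cong: prod.cong)
qed

text \<open>The point probabilities, read off from the exploration law with \<open>B = UNIV\<close>,
  already add up to one over the finite support, so no mass is left elsewhere.\<close>

lemma AE_arm: "AE \<omega> in M. X t \<omega> \<in> set_pmf \<pi>\<^sub>e"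
proof -
  have sub: "set_pmf \<pi>\<^sub>e \<subseteq> A" and fin: "finite (set_pmf \<pi>\<^sub>e)"
    using exploration_policy finite_arms by (auto simp: policies_def finite_subset)
  have [measurable]: "set_pmf \<pi>\<^sub>e \<in> sets borel"
    using fin by (simp add: finite_imp_closed borel_closed)
  have "prob {\<omega> \<in> space M. X t \<omega> \<in> set_pmf \<pi>\<^sub>e} =
      prob (\<Union>x\<in>set_pmf \<pi>\<^sub>e. {\<omega> \<in> space M. X t \<omega> = x})"
    by (rule arg_cong[where f=prob]) auto
  also have "\<dots> = (\<Sum>x\<in>set_pmf \<pi>\<^sub>e. prob {\<omega> \<in> space M. X t \<omega> = x})"
    using fin by (intro finite_measure_finite_Union) (auto simp: disjoint_family_on_def)
  also have "\<dots> = (\<Sum>x\<in>set_pmf \<pi>\<^sub>e. pmf \<pi>\<^sub>e x)"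
  proof (rule sum.cong)
    fix x assume "x \<in> set_pmf \<pi>\<^sub>e"
    then have x: "x \<in> A" using sub by auto
    interpret Px: prob_space "P x"
      using x by (rule prob_space_reward)
    have "measure (P x) UNIV = 1"
      using Px.prob_space sets_eq_imp_space_eq[OF sets_reward[OF x]] by simp
    then show "prob {\<omega> \<in> space M. X t \<omega> = x} = pmf \<pi>\<^sub>e x"
      using exploration_law[OF x, of UNIV t] by simp
  qed simp
  also have "\<dots> = 1"
    using fin by (intro sum_pmf_eq_1) auto
  finally show ?thesis
    by (subst (asm) prob_Collect_eq_1) simp_all
qed

lemma AE_arm_in_A: "AE \<omega> in M. \<forall>j. arm j \<omega> \<in> A"
proof -
  have "AE \<omega> in M. arm j \<omega> \<in> A" for j
    using AE_arm[of "projr j"] exploration_policy existing_arms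
    by (cases j) (auto simp: arm_def policies_def)
  then show ?thesis
    by (simp add: AE_all_countable)
qed

text \<open>The integrand is a product over rounds with a residual at the distinguished indices and
  1 elsewhere. A residual occurring alone in its round has mean zero and kills the product; two in
  the same round contribute \<sigma>^2.\<close>

lemma residual_moments:
  assumes J: "finite J" and \<alpha>: "\<And>i. i \<in> J \<Longrightarrow> \<alpha> i \<in> A"
  shows "has_bochner_integral M (\<lambda>\<omega>. \<Prod>i\<in>J. of_bool (arm i \<omega> = \<alpha> i)) (\<Prod>i\<in>J. arm_prob i (\<alpha> i))"
    and "j \<in> J \<Longrightarrow> has_bochner_integral M
      (\<lambda>\<omega>. (\<Prod>i\<in>J. of_bool (arm i \<omega> = \<alpha> i)) * (reward j \<omega> - \<alpha> j \<bullet> \<theta>)) 0"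
    and "j \<in> J \<Longrightarrow> k \<in> J \<Longrightarrow> has_bochner_integral M
      (\<lambda>\<omega>. (\<Prod>i\<in>J. of_bool (arm i \<omega> = \<alpha> i)) * ((reward j \<omega> - \<alpha> j \<bullet> \<theta>) * (reward k \<omega> - \<alpha> k \<bullet> \<theta>)))
      (if j = k then \<sigma>\<^sup>2 * (\<Prod>i\<in>J. arm_prob i (\<alpha> i)) else 0)"
proof -
  show "has_bochner_integral M (\<lambda>\<omega>. \<Prod>i\<in>J. of_bool (arm i \<omega> = \<alpha> i)) (\<Prod>i\<in>J. arm_prob i (\<alpha> i))"
    using has_integral_prod_on_arms[OF J \<alpha>, where g="\<lambda>_ _. 1" and m="\<lambda>_. 1"] reward_moments(1)[OF \<alpha>]
    by simp
next
  assume j: "j \<in> J"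
  have "has_bochner_integral M (\<lambda>\<omega>. \<Prod>i\<in>J. of_bool (arm i \<omega> = \<alpha> i) * (if i = j then reward i \<omega> - \<alpha> i \<bullet> \<theta> else 1))
      (\<Prod>i\<in>J. arm_prob i (\<alpha> i) * (if i = j then 0 else 1))"
    by (rule has_integral_prod_on_arms[OF J \<alpha>, where g="\<lambda>i r. if i = j then r - \<alpha> i \<bullet> \<theta> else 1"])
      (use reward_moments[OF \<alpha>] in auto)
  then show "has_bochner_integral M
      (\<lambda>\<omega>. (\<Prod>i\<in>J. of_bool (arm i \<omega> = \<alpha> i)) * (reward j \<omega> - \<alpha> j \<bullet> \<theta>)) 0"
    using J j by (simp add: prod.distrib prod.delta)
next
  assume j: "j \<in> J" and k: "k \<in> J"
  let ?g = "\<lambda>l i r. if i = l then r - \<alpha> i \<bullet> \<theta> else 1"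
  \<comment> \<open>The cases are both residuals in round \<open>i\<close>, exactly one, and
    none.\<close>
  let ?m = "\<lambda>i. if i = j \<and> i = k then \<sigma>\<^sup>2 else if i = j \<or> i = k then 0 else 1"
  have "has_bochner_integral M (\<lambda>\<omega>. \<Prod>i\<in>J. of_bool (arm i \<omega> = \<alpha> i) * (?g j i (reward i \<omega>) * ?g k i (reward i \<omega>)))
      (\<Prod>i\<in>J. arm_prob i (\<alpha> i) * ?m i)"
    by (rule has_integral_prod_on_arms[OF J \<alpha>, where g="\<lambda>i r. ?g j i r * ?g k i r"])
      (use reward_moments[OF \<alpha>] in auto)
  moreover have "(\<Prod>i\<in>J. ?m i) = (if j = k then \<sigma>\<^sup>2 else 0)"
  proof (cases "j = k")
    case True
    then have "(\<Prod>i\<in>J. ?m i) = (\<Prod>i\<in>J. if i = j then \<sigma>\<^sup>2 else 1)"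
      by (intro prod.cong) auto
    then show ?thesis using J j True by simp
  next
    case False
    then show ?thesis using J j by (auto intro!: prod_zero)
  qed
  ultimately show "has_bochner_integral M
      (\<lambda>\<omega>. (\<Prod>i\<in>J. of_bool (arm i \<omega> = \<alpha> i)) * ((reward j \<omega> - \<alpha> j \<bullet> \<theta>) * (reward k \<omega> - \<alpha> k \<bullet> \<theta>)))
      (if j = k then \<sigma>\<^sup>2 * (\<Prod>i\<in>J. arm_prob i (\<alpha> i)) else 0)"
    using J j k by (cases "j = k") (simp_all add: prod.distrib prod.delta mult.commute[of "\<sigma>\<^sup>2"])
qed

section \<open>The estimator as a function of the combined rounds\<close>

definition rounds :: "nat \<Rightarrow> ('n + nat) set" where
  "rounds T = range Inl \<union> Inr ` {..<T}"

abbreviation design :: "nat \<Rightarrow> 'w \<Rightarrow> real^'d^'d" where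
  "design T \<omega> \<equiv> (\<Sum>t<T. outer (X t \<omega>)) + transpose \<Phi>\<^sub>0 ** \<Phi>\<^sub>0"

lemma finite_rounds: "finite (rounds T)"
  by (simp add: rounds_def)

lemma sum_rounds: "(\<Sum>j\<in>rounds T. f j) = (\<Sum>t<T. f (Inr t)) + (\<Sum>i\<in>UNIV. f (Inl i))"
  unfolding rounds_def by (subst sum.union_disjoint) (auto simp: sum.reindex add.commute)

lemma design_eq_gram: "design T \<omega> = gram (\<lambda>j. arm j \<omega>) (rounds T)"
  by (simp add: gram_def sum_rounds transpose_mult_self arm_def)

lemma invertible_design: "invertible (design T \<omega>)"
  using full_column_rank by (intro invertible_add_full_rank psd_sum psd_outer)

lemma V_DM_eq:
  "V_DM A \<pi> (existing_data \<Phi>\<^sub>0 R\<^sub>0 \<omega> + exploration_data X R T \<omega>) =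
    mean_feature A \<pi> \<bullet> (matrix_inv (design T \<omega>) *v (\<Sum>j\<in>rounds T. reward j \<omega> *\<^sub>R arm j \<omega>))"
proof -
  let ?D = "existing_data \<Phi>\<^sub>0 R\<^sub>0 \<omega> + exploration_data X R T \<omega>"
  have "(\<Sum>(x, r)\<in>#?D. outer x) = design T \<omega>"
    by (simp add: existing_data_def exploration_data_def image_mset.compositionality comp_def
        sum_unfold_sum_mset[symmetric] transpose_mult_self gram_def add.commute)
  moreover have "(\<Sum>(x, r)\<in>#?D. r *\<^sub>R x) = (\<Sum>j\<in>rounds T. reward j \<omega> *\<^sub>R arm j \<omega>)"
    by (simp add: existing_data_def exploration_data_def image_mset.compositionality comp_def
        sum_unfold_sum_mset[symmetric] sum_rounds arm_def reward_def add.commute)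
  ultimately show ?thesis
    by (simp add: V_DM_def least_squares_def pinv_invertible invertible_design)
qed

lemma borel_measurable_design_inv_mult:
  assumes "\<And>i. (\<lambda>\<omega>. b \<omega> $ i) \<in> borel_measurable M"
  shows "(\<lambda>\<omega>. \<phi> \<bullet> (matrix_inv (design T \<omega>) *v b \<omega>)) \<in> borel_measurable M"
proof (rule borel_measurable_matrix_inv_mult)
  have eq: "design T \<omega> $ i $ k = (\<Sum>t<T. X t \<omega> $ i * X t \<omega> $ k) + (transpose \<Phi>\<^sub>0 ** \<Phi>\<^sub>0) $ i $ k"
    for \<omega> i k
    by (simp add: outer_def)
  show "(\<lambda>\<omega>. design T \<omega> $ i $ k) \<in> borel_measurable M" for i k
    unfolding eq by measurable
qed (use assms invertible_design in auto)

text \<open>Configurations may contradict the fixed existing arms, and then their Gram matrix can be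
  singular; the point masses give them weight zero. All others contain the full-rank existing
  block.\<close>

lemma weight_zero_or_invertible:
  "(\<Prod>i\<in>rounds T. arm_prob i (\<alpha> i)) = 0 \<or> invertible (gram \<alpha> (rounds T))"
proof (cases "\<forall>i. \<alpha> (Inl i) = \<Phi>\<^sub>0 $ i")
  case True
  then have "gram \<alpha> (rounds T) = (\<Sum>t<T. outer (\<alpha> (Inr t))) + transpose \<Phi>\<^sub>0 ** \<Phi>\<^sub>0"
    by (simp add: gram_def sum_rounds transpose_mult_self)
  then show ?thesis
    using full_column_rank by (simp add: invertible_add_full_rank psd_sum psd_outer)
next
  case False
  then obtain i where "\<alpha> (Inl i) \<noteq> \<Phi>\<^sub>0 $ i"
    by auto
  then have "arm_prob (Inl i) (\<alpha> (Inl i)) = 0"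
    by (auto simp: arm_prob_def)
  moreover have "Inl i \<in> rounds T"
    by (simp add: rounds_def)
  ultimately show ?thesis
    using finite_rounds by (intro disjI1 prod_zero) auto
qed

text \<open>Conditioning on the arms is replaced by a sum over the finitely many arm configurations
  \<open>\<alpha>\<close>, on each of which the leverages are constants.\<close>

lemma estimator_moments:
  fixes \<phi> :: "real^'d" and T :: nat
  defines "est \<equiv> \<lambda>\<omega>. \<phi> \<bullet> (matrix_inv (design T \<omega>) *v (\<Sum>j\<in>rounds T. reward j \<omega> *\<^sub>R arm j \<omega>))"
    and "q \<equiv> \<lambda>\<omega>. \<phi> \<bullet> (matrix_inv (design T \<omega>) *v \<phi>)"
  shows "has_bochner_integral M (\<lambda>\<omega>. est \<omega> - \<phi> \<bullet> \<theta>) 0"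
    and "has_bochner_integral M (\<lambda>\<omega>. (est \<omega> - \<phi> \<bullet> \<theta>)\<^sup>2) (\<sigma>\<^sup>2 * expectation q)"
proof -
  define J where "J = rounds T"
  have J: "finite J" by (simp add: J_def finite_rounds)
  define lev where "lev a j = (matrix_inv (gram a J) *v \<phi>) \<bullet> a j" for a and j :: "'n + nat"
  define ind where "ind \<alpha> \<omega> = (\<Prod>j\<in>J. of_bool (arm j \<omega> = \<alpha> j) :: real)" for \<alpha> \<omega>
  define W where "W \<alpha> = (\<Prod>j\<in>J. arm_prob j (\<alpha> j))" for \<alpha>
  define err where "err \<alpha> \<omega> = (\<Sum>j\<in>J. lev \<alpha> j * (reward j \<omega> - \<alpha> j \<bullet> \<theta>))" for \<alpha> \<omega>
  define form where "form \<alpha> = \<phi> \<bullet> (matrix_inv (gram \<alpha> J) *v \<phi>)" for \<alpha>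
  have gram_restrict: "gram (restrict a J) J = gram a J" for a :: "'n + nat \<Rightarrow> real^'d"
    by (simp add: gram_def)
  \<comment> \<open>The arms are restricted to \<open>J\<close> because configurations are
    extensional; the Gram matrix sees only the values on \<open>J\<close>.\<close>
  have est_err: "est \<omega> - \<phi> \<bullet> \<theta> = err (restrict (\<lambda>j. arm j \<omega>) J) \<omega>" for \<omega>
    using least_squares_error[of "\<lambda>j. arm j \<omega>" J \<phi> "\<lambda>j. reward j \<omega>" \<theta>] invertible_design[where T=T and \<omega>=\<omega>]
    by (simp add: est_def err_def lev_def gram_restrict design_eq_gram flip: J_def)
  have q_form: "q \<omega> = form (restrict (\<lambda>j. arm j \<omega>) J)" for \<omega>
    by (simp add: q_def form_def gram_restrict design_eq_gram flip: J_def)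
  have est_meas: "est \<in> borel_measurable M"
    unfolding est_def
    by (rule borel_measurable_design_inv_mult) (simp add: sum_component)
  have q_meas: "q \<in> borel_measurable M"
    unfolding q_def by (rule borel_measurable_design_inv_mult) simp
  have expand: "AE \<omega> in M. H \<omega> (restrict (\<lambda>j. arm j \<omega>) J) = (\<Sum>\<alpha>\<in>PiE J (\<lambda>_. A). ind \<alpha> \<omega> * H \<omega> \<alpha>)"
    for H :: "'w \<Rightarrow> ('n + nat \<Rightarrow> real^'d) \<Rightarrow> real"
    using AE_arm_in_A
    by eventually_elim (simp add: ind_def sum_configurations J finite_arms)
  \<comment> \<open>\<open>f\<close> agrees almost everywhere with a finite sum over configurations,
    so its integral is the sum of theirs. Measurability of \<open>f\<close> is supplied separately,
    as almost-everywhere equality alone does not give it.\<close>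
  have transfer: "has_bochner_integral M f m"
    if f: "f \<in> borel_measurable M" "\<And>\<omega>. f \<omega> = H \<omega> (restrict (\<lambda>j. arm j \<omega>) J)"
      and H: "\<And>\<alpha>. \<alpha> \<in> PiE J (\<lambda>_. A) \<Longrightarrow> has_bochner_integral M (\<lambda>\<omega>. ind \<alpha> \<omega> * H \<omega> \<alpha>) (h \<alpha>)"
      and m: "m = (\<Sum>\<alpha>\<in>PiE J (\<lambda>_. A). h \<alpha>)" for f H h and m :: real
  proof -
    have sum: "has_bochner_integral M (\<lambda>\<omega>. \<Sum>\<alpha>\<in>PiE J (\<lambda>_. A). ind \<alpha> \<omega> * H \<omega> \<alpha>) m"
      unfolding m by (rule has_bochner_integral_sum) (rule H)
    have "AE \<omega> in M. f \<omega> = (\<Sum>\<alpha>\<in>PiE J (\<lambda>_. A). ind \<alpha> \<omega> * H \<omega> \<alpha>)"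
      using expand[of H] by (simp add: f(2))
    then show ?thesis
      using sum f(1) has_bochner_integral_cong_AE borel_measurable_has_bochner_integral by blast
  qed
  have \<alpha>: "\<alpha> i \<in> A" if "\<alpha> \<in> PiE J (\<lambda>_. A)" "i \<in> J" for \<alpha> i
    using that by auto
  have first: "has_bochner_integral M (\<lambda>\<omega>. ind \<alpha> \<omega> * err \<alpha> \<omega>) 0" if "\<alpha> \<in> PiE J (\<lambda>_. A)" for \<alpha>
  proof -
    have "has_bochner_integral M (\<lambda>\<omega>. \<Sum>j\<in>J. lev \<alpha> j * (ind \<alpha> \<omega> * (reward j \<omega> - \<alpha> j \<bullet> \<theta>)))
        (\<Sum>j\<in>J. lev \<alpha> j * 0)"
      unfolding ind_def
      by (intro has_bochner_integral_sum has_bochner_integral_mult_right residual_moments(2) J \<alpha>[OF that])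
    then show ?thesis
      by (simp add: err_def sum_distrib_left ac_simps)
  qed
  show "has_bochner_integral M (\<lambda>\<omega>. est \<omega> - \<phi> \<bullet> \<theta>) 0"
  proof (rule transfer[of _ "\<lambda>\<omega> \<alpha>. err \<alpha> \<omega>", OF _ est_err first])
    show "(\<lambda>\<omega>. est \<omega> - \<phi> \<bullet> \<theta>) \<in> borel_measurable M"
      using est_meas by simp
  qed auto
  have second: "has_bochner_integral M (\<lambda>\<omega>. ind \<alpha> \<omega> * (err \<alpha> \<omega>)\<^sup>2) (\<sigma>\<^sup>2 * (W \<alpha> * form \<alpha>))"
    if "\<alpha> \<in> PiE J (\<lambda>_. A)" for \<alpha>
  proof -
    \<comment> \<open>The square of the error is expanded into a double sum, of which only the
      diagonal survives integration.\<close>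
    have "has_bochner_integral M (\<lambda>\<omega>. \<Sum>j\<in>J. \<Sum>k\<in>J. (lev \<alpha> j * lev \<alpha> k) *
          (ind \<alpha> \<omega> * ((reward j \<omega> - \<alpha> j \<bullet> \<theta>) * (reward k \<omega> - \<alpha> k \<bullet> \<theta>))))
        (\<Sum>j\<in>J. \<Sum>k\<in>J. (lev \<alpha> j * lev \<alpha> k) * (if j = k then \<sigma>\<^sup>2 * W \<alpha> else 0))"
      unfolding ind_def W_def
      by (intro has_bochner_integral_sum has_bochner_integral_mult_right residual_moments(3) J \<alpha>[OF that])
    also have "(\<lambda>\<omega>. \<Sum>j\<in>J. \<Sum>k\<in>J. (lev \<alpha> j * lev \<alpha> k) *
          (ind \<alpha> \<omega> * ((reward j \<omega> - \<alpha> j \<bullet> \<theta>) * (reward k \<omega> - \<alpha> k \<bullet> \<theta>)))) =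
        (\<lambda>\<omega>. ind \<alpha> \<omega> * (err \<alpha> \<omega>)\<^sup>2)"
      by (simp add: err_def power2_eq_square sum_product sum_distrib_left ac_simps)
    also have "(\<Sum>j\<in>J. \<Sum>k\<in>J. (lev \<alpha> j * lev \<alpha> k) * (if j = k then \<sigma>\<^sup>2 * W \<alpha> else 0)) =
        (\<sigma>\<^sup>2 * W \<alpha>) * (\<Sum>j\<in>J. (lev \<alpha> j)\<^sup>2)"
      using J by (simp add: if_distrib[of "(*) _"] sum.delta sum_distrib_left power2_eq_square ac_simps cong: if_cong)
    also have "\<dots> = \<sigma>\<^sup>2 * (W \<alpha> * form \<alpha>)"
      \<comment> \<open>Either the weight makes both sides zero, or the Gram matrix is invertible
        and the squared leverages sum to the inverse form.\<close>
      using weight_zero_or_invertible[where T=T and \<alpha>=\<alpha>] sum_leverage_squares[of \<alpha> J \<phi>]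
      by (auto simp: W_def lev_def form_def J_def)
    finally show ?thesis .
  qed
  have "has_bochner_integral M q (\<Sum>\<alpha>\<in>PiE J (\<lambda>_. A). W \<alpha> * form \<alpha>)"
  proof (rule transfer[of _ "\<lambda>\<omega> \<alpha>. form \<alpha>"])
    show "has_bochner_integral M (\<lambda>\<omega>. ind \<alpha> \<omega> * form \<alpha>) (W \<alpha> * form \<alpha>)" if "\<alpha> \<in> PiE J (\<lambda>_. A)" for \<alpha>
      unfolding ind_def W_def
      by (intro has_bochner_integral_mult_left residual_moments(1) J \<alpha>[OF that])
  qed (use q_meas q_form in auto)
  then have mean: "expectation q = (\<Sum>\<alpha>\<in>PiE J (\<lambda>_. A). W \<alpha> * form \<alpha>)"
    by (simp add: has_bochner_integral_iff)
  show "has_bochner_integral M (\<lambda>\<omega>. (est \<omega> - \<phi> \<bullet> \<theta>)\<^sup>2) (\<sigma>\<^sup>2 * expectation q)"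
  proof (rule transfer[of _ "\<lambda>\<omega> \<alpha>. (err \<alpha> \<omega>)\<^sup>2", OF _ _ second])
    show "(\<lambda>\<omega>. (est \<omega> - \<phi> \<bullet> \<theta>)\<^sup>2) \<in> borel_measurable M"
      using est_meas by simp
    show "\<sigma>\<^sup>2 * expectation q = (\<Sum>\<alpha>\<in>PiE J (\<lambda>_. A). \<sigma>\<^sup>2 * (W \<alpha> * form \<alpha>))"
      by (simp add: mean sum_distrib_left)
  qed (simp_all add: est_err)
qed

text \<open>The difference of the two value estimates is the estimator for the difference of mean
  features. It is unbiased, so its variance is the second moment of its error.\<close>

lemma nu_star_eq: "nu_star M A \<pi>\<^sub>1 \<pi>\<^sub>0 \<Phi>\<^sub>0 R\<^sub>0 X R T = \<sigma>\<^sup>2 * expected_form M A \<pi>\<^sub>1 \<pi>\<^sub>0 \<Phi>\<^sub>0 X T"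
proof -
  define \<phi> where "\<phi> = mean_feature A \<pi>\<^sub>1 - mean_feature A \<pi>\<^sub>0"
  define est where "est \<omega> = \<phi> \<bullet> (matrix_inv (design T \<omega>) *v (\<Sum>j\<in>rounds T. reward j \<omega> *\<^sub>R arm j \<omega>))" for \<omega>
  note moments = estimator_moments[of \<phi> T, folded est_def]
  have "has_bochner_integral M (\<lambda>\<omega>. (est \<omega> - \<phi> \<bullet> \<theta>) + \<phi> \<bullet> \<theta>) (0 + \<phi> \<bullet> \<theta>)"
    by (intro has_bochner_integral_add moments(1)) (simp add: has_bochner_integral_iff prob_space)
  then have "expectation est = \<phi> \<bullet> \<theta>"
    by (simp add: has_bochner_integral_iff)
  moreover have "V_DM A \<pi>\<^sub>1 (existing_data \<Phi>\<^sub>0 R\<^sub>0 \<omega> + exploration_data X R T \<omega>) -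
      V_DM A \<pi>\<^sub>0 (existing_data \<Phi>\<^sub>0 R\<^sub>0 \<omega> + exploration_data X R T \<omega>) = est \<omega>" for \<omega>
    by (simp add: V_DM_eq est_def \<phi>_def inner_diff_left)
  then have "nu_star M A \<pi>\<^sub>1 \<pi>\<^sub>0 \<Phi>\<^sub>0 R\<^sub>0 X R T = variance est"
    by (simp add: nu_star_def)
  ultimately show ?thesis
    using moments(2) by (simp add: has_bochner_integral_iff expected_form_def Let_def \<phi>_def)
qed

section \<open>Concentration of the design matrix\<close>

definition pulls :: "nat \<Rightarrow> real^'d \<Rightarrow> 'w \<Rightarrow> real" where
  "pulls T x \<omega> = (\<Sum>t<T. of_bool (X t \<omega> = x))"

text \<open>Hoeffding's inequality for T independent indicators: each has range 1, so the squared
  ranges add up to T.\<close>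

lemma pulls_concentration:
  assumes x: "x \<in> A" and T: "0 < T" and \<epsilon>: "0 \<le> \<epsilon>"
  shows "prob {\<omega> \<in> space M. \<epsilon> \<le> \<bar>pulls T x \<omega> - T * pmf \<pi>\<^sub>e x\<bar>} \<le> 2 * exp (- 2 * \<epsilon>\<^sup>2 / T)"
proof -
  let ?I = "Inr ` {..<T} :: ('n + nat) set"
  let ?Y = "\<lambda>j \<omega>. of_bool (arm j \<omega> = x) :: real"
  have mean: "(\<Sum>j\<in>?I. expectation (?Y j)) = T * pmf \<pi>\<^sub>e x"
    using has_integral_on_arm[OF x reward_moments(1)[OF x]]
    by (simp add: has_bochner_integral_iff sum.reindex arm_prob_def)
  have "indep_vars (\<lambda>_. borel) (\<lambda>j \<omega>. (\<lambda>(y, r). of_bool (y = x) :: real) (arm j \<omega>, reward j \<omega>)) ?I"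
  proof (rule indep_vars_compose2[where M'="\<lambda>_. borel" and N="\<lambda>_. borel" and
        X="\<lambda>j \<omega>. (arm j \<omega>, reward j \<omega>)" and Y="\<lambda>_ (y, r). of_bool (y = x)"])
    show "indep_vars (\<lambda>_. borel) (\<lambda>j \<omega>. (arm j \<omega>, reward j \<omega>)) ?I"
      using indep_pairs by (rule indep_vars_subset) simp
    show "(\<lambda>(y, r). of_bool (y = x) :: real) \<in> borel_measurable (borel :: ((real^'d) \<times> real) measure)"
      unfolding borel_prod[symmetric] by measurable
  qed
  then interpret Hoeffding_ineq M ?I ?Y "\<lambda>_. 0" "\<lambda>_. 1" "T * pmf \<pi>\<^sub>e x"
    by unfold_locales (simp_all add: mean)
  have width: "(\<Sum>j\<in>?I. ((1::real) - 0)\<^sup>2) = T"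
    by (simp add: card_image)
  have pulls: "(\<Sum>j\<in>?I. ?Y j \<omega>) = pulls T x \<omega>" for \<omega>
    unfolding pulls_def by (subst sum.reindex) (simp_all add: arm_def)
  show ?thesis
    using Hoeffding_ineq_abs_ge[OF \<epsilon>, unfolded width pulls] T by simp
qed

section \<open>Loewner comparison of the random and the mean design\<close>

abbreviation existing_gram :: "real^'d^'d" where
  "existing_gram \<equiv> transpose \<Phi>\<^sub>0 ** \<Phi>\<^sub>0"

abbreviation mean_design :: "nat \<Rightarrow> real^'d^'d" where
  "mean_design T \<equiv> real T *\<^sub>R policy_gram A \<pi>\<^sub>e + existing_gram"

lemma psd_existing_gram: "psd existing_gram"
  by (simp add: transpose_mult_self psd_gram)

lemma psd_design: "psd (design T \<omega>)"
  by (simp add: psd_add psd_sum psd_outer psd_existing_gram)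

lemma psd_mean_design: "psd (mean_design T)"
  by (simp add: psd_add psd_scaleR psd_policy_gram psd_existing_gram)

lemma invertible_mean_design: "invertible (mean_design T)"
  using full_column_rank by (simp add: invertible_add_full_rank psd_scaleR psd_policy_gram)

lemma invertible_existing_gram: "invertible existing_gram"
  using full_column_rank invertible_add_full_rank[of 0] by (simp add: psd_def)

lemma mean_design_form:
  "v \<bullet> (mean_design T *v v) = (\<Sum>x\<in>A. T * pmf \<pi>\<^sub>e x * (x \<bullet> v)\<^sup>2) + v \<bullet> (existing_gram *v v)"
  by (simp add: matrix_vector_mult_add_rdistrib inner_add_right policy_gram_def sum_matrix_vector_mult
      inner_sum_right outer_mult_vector sum_distrib_left power2_eq_square inner_commute ac_simps
      flip: scaleR_matrix_vector_assoc)

text \<open>Grouping the rounds by the arm pulled gives the shape of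
  \<open>mean_design_form\<close>, with pull counts in place of their means.\<close>

lemma design_form:
  assumes "\<And>t. X t \<omega> \<in> A"
  shows "v \<bullet> (design T \<omega> *v v) = (\<Sum>x\<in>A. pulls T x \<omega> * (x \<bullet> v)\<^sup>2) + v \<bullet> (existing_gram *v v)"
proof -
  have "(X t \<omega> \<bullet> v)\<^sup>2 = (\<Sum>x\<in>A. of_bool (X t \<omega> = x) * (x \<bullet> v)\<^sup>2)" for t
    using assms[of t] finite_arms by (simp add: sum.delta if_distrib[of "\<lambda>b. b * _"] of_bool_def cong: if_cong)
  then have "(\<Sum>t<T. (X t \<omega> \<bullet> v)\<^sup>2) = (\<Sum>x\<in>A. pulls T x \<omega> * (x \<bullet> v)\<^sup>2)"
    by (simp add: pulls_def sum_distrib_right sum.swap[of _ A])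
  then show ?thesis
    by (simp add: matrix_vector_mult_add_rdistrib inner_add_right sum_matrix_vector_mult
        inner_sum_right outer_mult_vector power2_eq_square inner_commute)
qed

text \<open>Adding a positive semidefinite matrix to the existing Gram matrix can only lower the
  inverse form. The bound is uniform in T and the sample, as needed on the exceptional
  event.\<close>

lemma design_inv_form_bounds:
  shows "0 \<le> \<phi> \<bullet> (matrix_inv (design T \<omega>) *v \<phi>)"
    and "\<phi> \<bullet> (matrix_inv (design T \<omega>) *v \<phi>) \<le> \<phi> \<bullet> (matrix_inv existing_gram *v \<phi>)"
    and "0 \<le> \<phi> \<bullet> (matrix_inv (mean_design T) *v \<phi>)"
    and "\<phi> \<bullet> (matrix_inv (mean_design T) *v \<phi>) \<le> \<phi> \<bullet> (matrix_inv existing_gram *v \<phi>)"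
proof -
  have mono: "\<phi> \<bullet> (matrix_inv (G + existing_gram) *v \<phi>) \<le> \<phi> \<bullet> (matrix_inv existing_gram *v \<phi>)"
    if G: "psd G" for G
  proof -
    have "1 * (v \<bullet> (existing_gram *v v)) \<le> v \<bullet> ((G + existing_gram) *v v)" for v
      using G by (simp add: psd_def matrix_vector_mult_add_rdistrib inner_add_right)
    from matrix_inv_form_antimono[OF psd_existing_gram invertible_existing_gram
        invertible_add_full_rank[OF G full_column_rank] zero_less_one this]
    show ?thesis by simp
  qed
  show "\<phi> \<bullet> (matrix_inv (design T \<omega>) *v \<phi>) \<le> \<phi> \<bullet> (matrix_inv existing_gram *v \<phi>)"
    by (intro mono psd_sum psd_outer)
  show "\<phi> \<bullet> (matrix_inv (mean_design T) *v \<phi>) \<le> \<phi> \<bullet> (matrix_inv existing_gram *v \<phi>)"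
    by (intro mono psd_scaleR psd_policy_gram) simp
qed (intro matrix_inv_form_nonneg psd_design psd_mean_design invertible_design invertible_mean_design)+

lemma design_inv_form_close:
  assumes arms: "\<And>t. X t \<omega> \<in> A" and \<delta>: "0 \<le> \<delta>" "\<delta> \<le> 1 / 2"
    and close: "\<And>x. x \<in> A \<Longrightarrow> \<bar>pulls T x \<omega> - T * pmf \<pi>\<^sub>e x\<bar> \<le> \<delta> * (T * pmf \<pi>\<^sub>e x)"
  shows "\<bar>\<phi> \<bullet> (matrix_inv (mean_design T) *v \<phi>) - \<phi> \<bullet> (matrix_inv (design T \<omega>) *v \<phi>)\<bar>
    \<le> 2 * \<delta> * (\<phi> \<bullet> (matrix_inv (mean_design T) *v \<phi>))"
proof -
  define q where "q = \<phi> \<bullet> (matrix_inv (design T \<omega>) *v \<phi>)"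
  define q' where "q' = \<phi> \<bullet> (matrix_inv (mean_design T) *v \<phi>)"
  have nonneg: "0 \<le> q" "0 \<le> q'"
    by (simp_all add: q_def q'_def design_inv_form_bounds)
  have lower: "(1 - \<delta>) * (v \<bullet> (mean_design T *v v)) \<le> v \<bullet> (design T \<omega> *v v)"
    and upper: "v \<bullet> (design T \<omega> *v v) \<le> (1 + \<delta>) * (v \<bullet> (mean_design T *v v))" for v
  proof -
    \<comment> \<open>The existing block is common to both designs; being nonnegative, its form lies
      between 1 - \<delta> and 1 + \<delta> times itself.\<close>
    have E: "0 \<le> \<delta> * (v \<bullet> (existing_gram *v v))"
      using \<delta>(1) psd_existing_gram by (simp add: psd_def)
    have "(1 - \<delta>) * (\<Sum>x\<in>A. T * pmf \<pi>\<^sub>e x * (x \<bullet> v)\<^sup>2) \<le> (\<Sum>x\<in>A. pulls T x \<omega> * (x \<bullet> v)\<^sup>2)"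
      unfolding sum_distrib_left
    proof (rule sum_mono)
      fix x assume "x \<in> A"
      from close[OF this] have "(1 - \<delta>) * (T * pmf \<pi>\<^sub>e x) \<le> pulls T x \<omega>"
        by (simp add: algebra_simps abs_le_iff)
      from mult_right_mono[OF this, of "(x \<bullet> v)\<^sup>2"]
      show "(1 - \<delta>) * (T * pmf \<pi>\<^sub>e x * (x \<bullet> v)\<^sup>2) \<le> pulls T x \<omega> * (x \<bullet> v)\<^sup>2"
        by (simp add: ac_simps)
    qed
    then show "(1 - \<delta>) * (v \<bullet> (mean_design T *v v)) \<le> v \<bullet> (design T \<omega> *v v)"
      using E unfolding design_form[OF arms] mean_design_form
      by (simp only: distrib_left left_diff_distrib)
    have "(\<Sum>x\<in>A. pulls T x \<omega> * (x \<bullet> v)\<^sup>2) \<le> (1 + \<delta>) * (\<Sum>x\<in>A. T * pmf \<pi>\<^sub>e x * (x \<bullet> v)\<^sup>2)"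
      unfolding sum_distrib_left
    proof (rule sum_mono)
      fix x assume "x \<in> A"
      from close[OF this] have "pulls T x \<omega> \<le> (1 + \<delta>) * (T * pmf \<pi>\<^sub>e x)"
        by (simp add: algebra_simps abs_le_iff)
      from mult_right_mono[OF this, of "(x \<bullet> v)\<^sup>2"]
      show "pulls T x \<omega> * (x \<bullet> v)\<^sup>2 \<le> (1 + \<delta>) * (T * pmf \<pi>\<^sub>e x * (x \<bullet> v)\<^sup>2)"
        by (simp add: ac_simps)
    qed
    then show "v \<bullet> (design T \<omega> *v v) \<le> (1 + \<delta>) * (v \<bullet> (mean_design T *v v))"
      using E unfolding design_form[OF arms] mean_design_form
      by (simp only: distrib_left distrib_right)
  qed
  have "(1 - \<delta>) * q \<le> q'"
    unfolding q_def q'_def using \<delta>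
    by (intro matrix_inv_form_antimono psd_mean_design invertible_mean_design invertible_design lower) simp
  \<comment> \<open>The upper comparison, divided by 1 + \<delta>, is used with the two designs
    exchanged.\<close>
  moreover have "1 / (1 + \<delta>) * q' \<le> q"
    unfolding q_def q'_def using \<delta> upper
    by (intro matrix_inv_form_antimono psd_design invertible_mean_design invertible_design)
      (simp_all add: field_simps)
  then have "q' \<le> (1 + \<delta>) * q"
    using \<delta> by (simp add: field_simps)
  \<comment> \<open>Both one-sided errors are at most \<delta> \<open>q\<close>; since 1 - \<delta>
    is at least 1/2, the random \<open>q\<close> can be traded for 2 \<open>q'\<close>.\<close>
  moreover have "q \<le> 2 * q'"
    using \<open>(1 - \<delta>) * q \<le> q'\<close> mult_right_mono[of "1/2" "1 - \<delta>" q] \<delta> nonneg by simp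
  then have "\<delta> * q \<le> 2 * \<delta> * q'"
    using mult_left_mono[of q "2 * q'" \<delta>] \<delta> by simp
  ultimately have "\<bar>q' - q\<bar> \<le> 2 * \<delta> * q'"
    by (simp add: algebra_simps abs_le_iff)
  then show ?thesis
    by (simp add: q_def q'_def)
qed

section \<open>Error bound and passage to the limit\<close>

lemma mean_design_inv_form_bound:
  assumes inv: "invertible (policy_gram A \<pi>\<^sub>e)"
  shows "T * (\<phi> \<bullet> (matrix_inv (mean_design T) *v \<phi>)) \<le> \<phi> \<bullet> (matrix_inv (policy_gram A \<pi>\<^sub>e) *v \<phi>)"
proof (cases "T = 0")
  case True
  then show ?thesis
    using inv by (simp add: matrix_inv_form_nonneg psd_policy_gram)
next
  case False
  \<comment> \<open>The mean design dominates T times the policy Gram matrix, which yields the rate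
    1/T. The comparison lemma needs a positive factor, hence the separate case T = 0.\<close>
  have "T * (v \<bullet> (policy_gram A \<pi>\<^sub>e *v v)) \<le> v \<bullet> (mean_design T *v v)" for v
    using psd_existing_gram
    by (simp add: psd_def matrix_vector_mult_add_rdistrib inner_add_right flip: scaleR_matrix_vector_assoc)
  with False show ?thesis
    by (intro matrix_inv_form_antimono psd_policy_gram inv invertible_mean_design) simp_all
qed

text \<open>The first term comes from the relative error off the exceptional event, with T
  \<open>q'\<close> bounded independently of T; the second is the uniform bound times the
  probability of that event.\<close>

lemma mean_inv_form_error:
  fixes \<phi> :: "real^'d" and T :: nat
  defines "q \<equiv> \<lambda>\<omega>. \<phi> \<bullet> (matrix_inv (design T \<omega>) *v \<phi>)"
    and "q' \<equiv> \<phi> \<bullet> (matrix_inv (mean_design T) *v \<phi>)"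
  assumes inv: "invertible (policy_gram A \<pi>\<^sub>e)" and T: "0 < T" and \<delta>: "0 \<le> \<delta>" "\<delta> \<le> 1 / 2"
  shows "T * \<bar>q' - expectation q\<bar> \<le> 2 * \<delta> * (\<phi> \<bullet> (matrix_inv (policy_gram A \<pi>\<^sub>e) *v \<phi>)) +
    T * (\<phi> \<bullet> (matrix_inv existing_gram *v \<phi>)) *
      (\<Sum>x\<in>set_pmf \<pi>\<^sub>e. 2 * exp (- 2 * (\<delta> * pmf \<pi>\<^sub>e x)\<^sup>2 * T))"
proof -
  define C where "C = \<phi> \<bullet> (matrix_inv existing_gram *v \<phi>)"
  define L where "L = \<phi> \<bullet> (matrix_inv (policy_gram A \<pi>\<^sub>e) *v \<phi>)"
  define dev where "dev x = {\<omega> \<in> space M. \<delta> * (T * pmf \<pi>\<^sub>e x) \<le> \<bar>pulls T x \<omega> - T * pmf \<pi>\<^sub>e x\<bar>}" for x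
  \<comment> \<open>Only the support is included: for an arm of probability zero the threshold is 0
    and \<open>dev x\<close> would be the whole space.\<close>
  define bad where "bad = (\<Union>x\<in>set_pmf \<pi>\<^sub>e. dev x)"
  have sub: "set_pmf \<pi>\<^sub>e \<subseteq> A" and fin: "finite (set_pmf \<pi>\<^sub>e)"
    using exploration_policy finite_arms by (auto simp: policies_def finite_subset)
  have dev [measurable]: "dev x \<in> events" for x
    unfolding dev_def pulls_def by measurable
  have bad [measurable]: "bad \<in> events"
    unfolding bad_def using fin by auto
  have C: "0 \<le> q \<omega>" "q \<omega> \<le> C" "0 \<le> q'" "q' \<le> C" for \<omega>
    by (simp_all add: q_def q'_def C_def design_inv_form_bounds)
  have q_meas [measurable]: "q \<in> borel_measurable M"
    unfolding q_def by (rule borel_measurable_design_inv_mult) simp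
  have int: "integrable M q"
    using C by (intro integrable_const_bound[of _ C]) auto
  have prob_dev: "prob (dev x) \<le> 2 * exp (- 2 * (\<delta> * pmf \<pi>\<^sub>e x)\<^sup>2 * T)" if "x \<in> set_pmf \<pi>\<^sub>e" for x
  proof -
    have "x \<in> A" using that sub by auto
    then have "prob (dev x) \<le> 2 * exp (- 2 * (\<delta> * (T * pmf \<pi>\<^sub>e x))\<^sup>2 / T)"
      unfolding dev_def using T \<delta> by (intro pulls_concentration) auto
    also have "- 2 * (\<delta> * (T * pmf \<pi>\<^sub>e x))\<^sup>2 / T = - 2 * (\<delta> * pmf \<pi>\<^sub>e x)\<^sup>2 * T"
      using T by (simp add: power2_eq_square)
    finally show ?thesis .
  qed
  have "prob bad \<le> (\<Sum>x\<in>set_pmf \<pi>\<^sub>e. prob (dev x))"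
    unfolding bad_def using fin by (intro finite_measure_subadditive_finite) auto
  also have "\<dots> \<le> (\<Sum>x\<in>set_pmf \<pi>\<^sub>e. 2 * exp (- 2 * (\<delta> * pmf \<pi>\<^sub>e x)\<^sup>2 * T))"
    using prob_dev by (rule sum_mono)
  finally have prob_bad: "prob bad \<le> (\<Sum>x\<in>set_pmf \<pi>\<^sub>e. 2 * exp (- 2 * (\<delta> * pmf \<pi>\<^sub>e x)\<^sup>2 * T))" .
  have "AE \<omega> in M. \<forall>t. X t \<omega> \<in> set_pmf \<pi>\<^sub>e"
    using AE_arm by (simp add: AE_all_countable)
  then have "AE \<omega> in M. \<bar>q' - q \<omega>\<bar> \<le> 2 * \<delta> * q' + C * indicator bad \<omega>"
    using AE_space
  proof eventually_elim
    case (elim \<omega>)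
    show ?case
    proof (cases "\<omega> \<in> bad")
      case True
      have "0 \<le> 2 * \<delta> * q'" using \<delta> C by simp
      \<comment> \<open>Both forms lie between 0 and \<open>C\<close>, so they differ by at most
        \<open>C\<close>.\<close>
      then show ?thesis
        using True C(1,2)[of \<omega>] C(3,4) by (simp add: abs_le_iff)
    next
      case False
      have "\<bar>pulls T x \<omega> - T * pmf \<pi>\<^sub>e x\<bar> \<le> \<delta> * (T * pmf \<pi>\<^sub>e x)" for x
      proof (cases "x \<in> set_pmf \<pi>\<^sub>e")
        case True
        then have "\<omega> \<notin> dev x"
          using False by (auto simp: bad_def)
        then show ?thesis
          using elim by (simp add: dev_def)
      next
        \<comment> \<open>An arm outside the support is never pulled on this sample and has expected
          count 0, so its deviation is 0.\<close>
        case x: False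
        then have "X t \<omega> \<noteq> x" for t
          using elim by auto
        with x show ?thesis
          by (simp add: pulls_def set_pmf_iff)
      qed
      moreover have "X t \<omega> \<in> A" for t
        using elim sub by auto
      ultimately have "\<bar>q' - q \<omega>\<bar> \<le> 2 * \<delta> * q'"
        unfolding q_def q'_def using \<delta> by (intro design_inv_form_close)
      then show ?thesis
        using False by simp
    qed
  qed
  moreover have int_bad: "integrable M (indicator bad :: 'w \<Rightarrow> real)"
    by (simp add: emeasure_eq_measure)
  ultimately have "(\<integral>\<omega>. \<bar>q' - q \<omega>\<bar> \<partial>M) \<le> (\<integral>\<omega>. 2 * \<delta> * q' + C * indicator bad \<omega> \<partial>M)"
    using int by (intro integral_mono_AE) auto
  also have "\<dots> = 2 * \<delta> * q' + C * prob bad"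
    using int_bad by (simp add: prob_space)
  finally have "(\<integral>\<omega>. \<bar>q' - q \<omega>\<bar> \<partial>M) \<le> 2 * \<delta> * q' + C * prob bad" .
  moreover have "\<bar>q' - expectation q\<bar> \<le> (\<integral>\<omega>. \<bar>q' - q \<omega>\<bar> \<partial>M)"
    using integral_norm_bound[of M "\<lambda>\<omega>. q' - q \<omega>"] int by (simp add: prob_space)
  ultimately have "T * \<bar>q' - expectation q\<bar> \<le> T * (2 * \<delta> * q' + C * prob bad)"
    by (intro mult_left_mono) auto
  also have "\<dots> = 2 * \<delta> * (T * q') + T * C * prob bad"
    by (simp add: algebra_simps)
  also have "\<dots> \<le> 2 * \<delta> * L + T * C * (\<Sum>x\<in>set_pmf \<pi>\<^sub>e. 2 * exp (- 2 * (\<delta> * pmf \<pi>\<^sub>e x)\<^sup>2 * T))"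
    using \<delta> C(3,4) mean_design_inv_form_bound[OF inv, of T \<phi>] prob_bad
    by (intro add_mono mult_left_mono) (auto simp: q'_def L_def)
  finally show ?thesis
    by (simp add: C_def L_def)
qed

text \<open>First \<delta> is fixed so that the relative error term is small for all T at once; with
  \<delta> fixed, the exponential tail beats the factor T.\<close>

lemma mean_inv_form_limit:
  assumes inv: "invertible (policy_gram A \<pi>\<^sub>e)"
  shows "(\<lambda>T. real T * \<bar>\<phi> \<bullet> (matrix_inv (mean_design T) *v \<phi>) -
      expectation (\<lambda>\<omega>. \<phi> \<bullet> (matrix_inv (design T \<omega>) *v \<phi>))\<bar>) \<longlonglongrightarrow> 0"
    (is "?f \<longlonglongrightarrow> 0")
proof -
  define C where "C = \<phi> \<bullet> (matrix_inv existing_gram *v \<phi>)"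
  define L where "L = \<phi> \<bullet> (matrix_inv (policy_gram A \<pi>\<^sub>e) *v \<phi>)"
  have L: "0 \<le> L"
    using inv by (simp add: L_def matrix_inv_form_nonneg psd_policy_gram)
  have geometric: "(\<lambda>T. real T * exp (- c * real T)) \<longlonglongrightarrow> 0" if "0 < c" for c
  proof -
    have "(\<lambda>T. real T * exp (- c) ^ T) \<longlonglongrightarrow> 0"
      using that by (intro powser_times_n_limit_0) simp
    then show ?thesis
      by (simp add: mult.commute flip: exp_of_nat_mult)
  qed
  show ?thesis
  proof (rule LIMSEQ_I)
    fix r :: real assume r: "0 < r"
    \<comment> \<open>The cap 1/2 is required by the closeness bound, and the other entry gives 2
      \<delta> L \<le> r/2; L + 1 keeps the denominator positive when L = 0.\<close>
    define \<delta> where "\<delta> = min (1 / 2) (r / (4 * (L + 1)))"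
    have \<delta>: "0 < \<delta>" "\<delta> \<le> 1 / 2" "\<delta> \<le> r / (4 * (L + 1))"
      using r L by (simp_all only: \<delta>_def min.cobounded1 min.cobounded2) simp
    have "2 * \<delta> * L \<le> 2 * (r / (4 * (L + 1))) * L"
      using \<delta> L by (intro mult_right_mono) auto
    also have "\<dots> \<le> r / 2"
      using r L by (simp add: field_simps)
    finally have half: "2 * \<delta> * L \<le> r / 2" .
    let ?tail = "\<lambda>T. real T * C * (\<Sum>x\<in>set_pmf \<pi>\<^sub>e. 2 * exp (- 2 * (\<delta> * pmf \<pi>\<^sub>e x)\<^sup>2 * T))"
    have "(\<lambda>T. \<Sum>x\<in>set_pmf \<pi>\<^sub>e. 2 * C * (real T * exp (- (2 * (\<delta> * pmf \<pi>\<^sub>e x)\<^sup>2) * real T)))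
        \<longlonglongrightarrow> (\<Sum>x\<in>set_pmf \<pi>\<^sub>e. 2 * C * 0)"
      \<comment> \<open>The exponential rates are positive because every arm of the support has
        nonzero probability.\<close>
      using \<delta> by (intro tendsto_sum tendsto_mult_left geometric) (simp add: set_pmf_iff)
    then have "?tail \<longlonglongrightarrow> 0"
      by (simp add: sum_distrib_left ac_simps)
    then obtain N where N: "\<And>T. T \<ge> N \<Longrightarrow> norm (?tail T - 0) < r / 2"
      using r LIMSEQ_D[of ?tail 0 "r / 2"] by auto
    \<comment> \<open>The maximum with 1 secures T > 0, which the error bound assumes.\<close>
    have "norm (?f T - 0) < r" if "T \<ge> max 1 N" for T
    proof -
      have "?f T \<le> 2 * \<delta> * L + ?tail T"
        unfolding C_def L_def using that \<delta> by (intro mean_inv_form_error inv) auto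
      moreover have "?tail T < r / 2"
        using N[of T] that by simp
      ultimately show ?thesis
        using half by simp
    qed
    then show "\<exists>N. \<forall>T\<ge>N. norm (?f T - 0) < r"
      by blast
  qed
qed

end

theorem theorem2:
  fixes A :: "(real^'d) set" and \<theta> :: "real^'d" and \<sigma> :: real
    and P :: "real^'d \<Rightarrow> real measure" and M :: "'w measure"
    and \<Phi>\<^sub>0 :: "real^'d^'n" and R\<^sub>0 :: "'n \<Rightarrow> 'w \<Rightarrow> real"
    and \<pi>\<^sub>0 \<pi>\<^sub>1 \<pi>\<^sub>e :: "(real^'d) pmf"
    and X :: "nat \<Rightarrow> 'w \<Rightarrow> real^'d" and R :: "nat \<Rightarrow> 'w \<Rightarrow> real"
  assumes "bandit_exploration A \<theta> \<sigma> P M \<Phi>\<^sub>0 R\<^sub>0 \<pi>\<^sub>e X R"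
    and "\<pi>\<^sub>1 \<in> policies A" and "\<pi>\<^sub>0 \<in> policies A"
    and "\<pi>\<^sub>e \<in> invertible_policies A"
  shows "(\<forall>T. nu_star M A \<pi>\<^sub>1 \<pi>\<^sub>0 \<Phi>\<^sub>0 R\<^sub>0 X R T = \<sigma>\<^sup>2 * expected_form M A \<pi>\<^sub>1 \<pi>\<^sub>0 \<Phi>\<^sub>0 X T) \<and>
    (\<lambda>T. real T * \<bar>nu A \<sigma> \<pi>\<^sub>1 \<pi>\<^sub>0 \<pi>\<^sub>e \<Phi>\<^sub>0 T - nu_star M A \<pi>\<^sub>1 \<pi>\<^sub>0 \<Phi>\<^sub>0 R\<^sub>0 X R T\<bar>)
      \<longlonglongrightarrow> 0"
proof -
  interpret bandit_exploration A \<theta> \<sigma> P M \<Phi>\<^sub>0 R\<^sub>0 \<pi>\<^sub>e X R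
    by fact
  define \<phi> where "\<phi> = mean_feature A \<pi>\<^sub>1 - mean_feature A \<pi>\<^sub>0"
  let ?gap = "\<lambda>T. \<phi> \<bullet> (matrix_inv (mean_design T) *v \<phi>) -
      expectation (\<lambda>\<omega>. \<phi> \<bullet> (matrix_inv (design T \<omega>) *v \<phi>))"
  have "nu A \<sigma> \<pi>\<^sub>1 \<pi>\<^sub>0 \<pi>\<^sub>e \<Phi>\<^sub>0 T - nu_star M A \<pi>\<^sub>1 \<pi>\<^sub>0 \<Phi>\<^sub>0 R\<^sub>0 X R T = \<sigma>\<^sup>2 * ?gap T" for T
    by (simp add: nu_star_eq nu_def expected_form_def Let_def right_diff_distrib flip: \<phi>_def)
  then have "real T * \<bar>nu A \<sigma> \<pi>\<^sub>1 \<pi>\<^sub>0 \<pi>\<^sub>e \<Phi>\<^sub>0 T - nu_star M A \<pi>\<^sub>1 \<pi>\<^sub>0 \<Phi>\<^sub>0 R\<^sub>0 X R T\<bar> =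
      \<sigma>\<^sup>2 * (real T * \<bar>?gap T\<bar>)" for T
    by (simp add: abs_mult)
  moreover have "(\<lambda>T. \<sigma>\<^sup>2 * (real T * \<bar>?gap T\<bar>)) \<longlonglongrightarrow> \<sigma>\<^sup>2 * 0"
    using assms(4) by (intro tendsto_mult_left mean_inv_form_limit) (simp add: invertible_policies_def)
  ultimately have "(\<lambda>T. real T * \<bar>nu A \<sigma> \<pi>\<^sub>1 \<pi>\<^sub>0 \<pi>\<^sub>e \<Phi>\<^sub>0 T - nu_star M A \<pi>\<^sub>1 \<pi>\<^sub>0 \<Phi>\<^sub>0 R\<^sub>0 X R T\<bar>)
      \<longlonglongrightarrow> 0"
    by (simp only: mult_zero_right)
  then show ?thesis
    using nu_star_eq by blast
qed

end
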